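(* Let $G$ be the Engel group. Then $$Z_3^{1,0}\cap\Omega_c^1(G)=\{X_1f\,\theta_1+X_2f\,\theta_2\mid f\in\mathcal C_c^\infty(G)\}=d_1\big(\mathcal C_c^\infty(G)\big).$$
   Context: The Engel group $G$ is the connected, simply connected Lie group whose Lie algebra has a basis $X_1,X_2,X_3,X_4$ with only non-zero brackets $[X_1,X_2]=X_3$, $[X_1,X_3]=X_4$. The $X_i$ are regarded as left-invariant vector fields and $\theta_1,\dots,\theta_4$ is the dual basis of left-invariant 1-forms ($d\theta_1=d\theta_2=0$, $d\theta_3=-\theta_1\wedge\theta_2$, $d\theta_4=-\theta_1\wedge\theta_3$). Weights: $\theta_1,\theta_2,\theta_3,\theta_4$ have weights $1,1,2,3$; weights add under wedge products; functions have weight $0$. $\Omega_c^{p,q}(G)$ is the space of compactly supported smooth $(p+q)$-forms that are $\mathcal C_c^\infty(G)$-combinations of left-invariant forms $\theta_{i_1}\wedge\dots\wedge\theta_{i_{p+q}}$ of weight $p$. The exterior differential splits as $d=d_0+d_1+d_2+d_3$, where $d_i$ raises weight by $i$; for $f$ smooth and $\xi$ left-invariant: $d_0(f\xi)=f\,d\xi$, $d_1(f\xi)=X_1f\,\theta_1\wedge\xi+X_2f\,\theta_2\wedge\xi$, $d_2(f\xi)=X_3f\,\theta_3\wedge\xi$, $d_3(f\xi)=X_4f\,\theta_4\wedge\xi$. $Z_3^{1,0}\cap\Omega_c^1(G)$ denotes the space of $\alpha\in\Omega_c^{1,0}(G)$ (i.e. $\alpha=f_1\theta_1+f_2\theta_2$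 with $f_i\in\mathcal C_c^\infty(G)$) such that $d_0\alpha=0$ and there exist compactly supported forms $z_2\in\Omega_c^{2,-1}(G)$, $z_3\in\Omega_c^{3,-2}(G)$ (multiples of $\theta_3$, $\theta_4$ respectively) with $d_1\alpha=d_0z_2$ and $d_2\alpha=d_0z_3+d_1z_2$. *)

theory Defs
  imports "HOL-Analysis.Analysis"
begin

section \<open>The Engel group in exponential coordinates\<close>

text \<open>
  A connected, simply connected nilpotent Lie group is its Lie algebra, equipped with the
  Baker-Campbell-Hausdorff product. The Engel algebra is \<open>real^4\<close> with basis \<open>X i = axis i 1\<close>;
  it has step 3, so the product stops after the third order terms.
\<close>

type_synonym engel = "real^4"

definition lie_bracket :: "engel \<Rightarrow> engel \<Rightarrow> engel" where
  "lie_bracket x y = (x$1 * y$2 - x$2 * y$1) *\<^sub>R axis 3 1 + (x$1 * y$3 - x$3 * y$1) *\<^sub>R axis 4 1"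

definition engel_mult :: "engel \<Rightarrow> engel \<Rightarrow> engel" (infixl \<open>\<odot>\<close> 70) where
  "x \<odot> y = x + y + (1/2) *\<^sub>R lie_bracket x y
     + (1/12) *\<^sub>R lie_bracket x (lie_bracket x y) + (1/12) *\<^sub>R lie_bracket y (lie_bracket y x)"

lemma vec4_eq_iff: "x = y \<longleftrightarrow> x$1 = y$1 \<and> x$2 = y$2 \<and> x$3 = y$3 \<and> x$4 = (y::'a^4)$4"
  by (simp add: vec_eq_iff forall_4)

lemma lie_bracket_nth [simp]:
  "lie_bracket x y $ 1 = 0" "lie_bracket x y $ 2 = 0"
  "lie_bracket x y $ 3 = x$1 * y$2 - x$2 * y$1" "lie_bracket x y $ 4 = x$1 * y$3 - x$3 * y$1"
  by (simp_all add: lie_bracket_def axis_def)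

lemma lie_bracket_axis:
  "lie_bracket (axis 1 1) (axis 2 1) = axis 3 1" "lie_bracket (axis 1 1) (axis 3 1) = axis 4 1"
  "lie_bracket (axis 1 1) (axis 4 1) = 0" "lie_bracket (axis 2 1) (axis 3 1) = 0"
  "lie_bracket (axis 2 1) (axis 4 1) = 0" "lie_bracket (axis 3 1) (axis 4 1) = 0"
  by (simp_all add: vec4_eq_iff axis_def)

lemma lie_bracket_anticomm: "lie_bracket y x = - lie_bracket x y"
  by (simp add: vec4_eq_iff)

lemma engel_group: "group engel_mult 0 uminus"
  by unfold_locales (simp_all add: engel_mult_def vec4_eq_iff field_simps)

section \<open>Smooth functions and left-invariant vector fields\<close>

primrec times_cont_diff :: "nat \<Rightarrow> ('a::real_normed_vector \<Rightarrow> 'b::real_normed_vector) \<Rightarrow> bool" where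
  "times_cont_diff 0 f \<longleftrightarrow> continuous_on UNIV f"
| "times_cont_diff (Suc n) f \<longleftrightarrow> (\<forall>x. f differentiable (at x)) \<and>
     (\<forall>v. times_cont_diff n (\<lambda>x. frechet_derivative f (at x) v))"

definition smooth :: "('a::real_normed_vector \<Rightarrow> 'b::real_normed_vector) \<Rightarrow> bool" where
  "smooth f \<longleftrightarrow> (\<forall>n. times_cont_diff n f)"

definition C_c_infinity :: "(engel \<Rightarrow> real) set" where
  "C_c_infinity = {f. smooth f \<and> compact (closure {x. f x \<noteq> 0})}"

text \<open>
  The one-parameter subgroup generated by \<open>axis i 1\<close> is \<open>t \<mapsto> t *\<^sub>R axis i 1\<close>, and the left-invariant
  field differentiates along its right translations. The target is a general vector space, so
  that the field also acts on the coefficients of forms.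
\<close>

definition X :: "4 \<Rightarrow> (engel \<Rightarrow> 'b::real_normed_vector) \<Rightarrow> engel \<Rightarrow> 'b" where
  "X i F x = vector_derivative (\<lambda>t. F (x \<odot> (t *\<^sub>R axis i 1))) (at 0)"

lemma X_left_invariant: "X i (\<lambda>x. F (g \<odot> x)) x = X i F (g \<odot> x)"
proof -
  interpret group engel_mult 0 uminus by (rule engel_group)
  show ?thesis by (simp add: X_def assoc)
qed

lemma X_eq_frechet_derivative:
  assumes "F differentiable (at x)"
  shows "X 1 F x = frechet_derivative F (at x)
           (axis 1 1 - (x$2 / 2) *\<^sub>R axis 3 1 - (x$3 / 2 + x$1 * x$2 / 12) *\<^sub>R axis 4 1)"
    and "X 2 F x = frechet_derivative F (at x)
           (axis 2 1 + (x$1 / 2) *\<^sub>R axis 3 1 + ((x$1)\<^sup>2 / 12) *\<^sub>R axis 4 1)"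
    and "X 3 F x = frechet_derivative F (at x) (axis 3 1 + (x$1 / 2) *\<^sub>R axis 4 1)"
    and "X 4 F x = frechet_derivative F (at x) (axis 4 1)"
proof -
  have key: "X i F x = frechet_derivative F (at x) v"
    if curve: "\<And>t. x \<odot> (t *\<^sub>R axis i 1) = x + t *\<^sub>R v + t\<^sup>2 *\<^sub>R w" for i v w
  proof -
    have F: "(F has_derivative frechet_derivative F (at x)) (at x)"
      using assms by (simp add: frechet_derivative_works)
    have "((\<lambda>t. x + t *\<^sub>R v + t\<^sup>2 *\<^sub>R w) has_derivative (\<lambda>t. t *\<^sub>R v)) (at (0::real))"
      by (auto intro!: derivative_eq_intros)
    with F have "((\<lambda>t. F (x + t *\<^sub>R v + t\<^sup>2 *\<^sub>R w)) has_derivative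
        (\<lambda>t. frechet_derivative F (at x) (t *\<^sub>R v))) (at (0::real))"
      using has_derivative_compose[of "\<lambda>t. x + t *\<^sub>R v + t\<^sup>2 *\<^sub>R w" "\<lambda>t. t *\<^sub>R v" "0::real" UNIV F
          "frechet_derivative F (at x)"] by simp
    then have "((\<lambda>t. F (x + t *\<^sub>R v + t\<^sup>2 *\<^sub>R w)) has_vector_derivative
        frechet_derivative F (at x) v) (at 0)"
      using has_derivative_linear[OF F]
      by (simp add: has_vector_derivative_def linear_cmul)
    then show ?thesis
      unfolding X_def curve by (rule vector_derivative_at)
  qed
  show "X 1 F x = frechet_derivative F (at x)
           (axis 1 1 - (x$2 / 2) *\<^sub>R axis 3 1 - (x$3 / 2 + x$1 * x$2 / 12) *\<^sub>R axis 4 1)"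
    by (rule key[where w = "(x$2 / 12) *\<^sub>R axis 4 1"])
      (simp add: engel_mult_def vec4_eq_iff axis_def power2_eq_square field_simps)
  show "X 2 F x = frechet_derivative F (at x)
           (axis 2 1 + (x$1 / 2) *\<^sub>R axis 3 1 + ((x$1)\<^sup>2 / 12) *\<^sub>R axis 4 1)"
    by (rule key[where w = 0])
      (simp add: engel_mult_def vec4_eq_iff axis_def power2_eq_square field_simps)
  show "X 3 F x = frechet_derivative F (at x) (axis 3 1 + (x$1 / 2) *\<^sub>R axis 4 1)"
    by (rule key[where w = 0])
      (simp add: engel_mult_def vec4_eq_iff axis_def power2_eq_square field_simps)
  show "X 4 F x = frechet_derivative F (at x) (axis 4 1)"
    by (rule key[where w = 0])
      (simp add: engel_mult_def vec4_eq_iff axis_def power2_eq_square field_simps)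
qed

section \<open>Differential forms in the left-invariant coframe\<close>

text \<open>
  A left-invariant form is an element of the exterior algebra of the dual Lie algebra. Its
  \<open>I\<close>-coordinate is the coefficient of \<open>\<theta> i\<^sub>1 \<and> \<dots> \<and> \<theta> i\<^sub>k\<close> for \<open>I = {i\<^sub>1, \<dots>, i\<^sub>k}\<close>
  with the indices in the order \<open>1, 2, 3, 4\<close>. In the type \<open>4\<close> of integers modulo 4 the index
  \<open>4\<close> equals \<open>0\<close> and comes first, so that order is restored by \<open>pos\<close>. A form on the group is
  a function with values in the exterior algebra.
\<close>

type_synonym covector = "real^(4 set)"
type_synonym form = "engel \<Rightarrow> covector"

definition pos :: "4 \<Rightarrow> nat" where
  "pos i = (if i = 1 then 1 else if i = 2 then 2 else if i = 3 then 3 else 4)"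

definition weight :: "4 \<Rightarrow> nat" where
  "weight i = (if i = 1 \<or> i = 2 then 1 else if i = 3 then 2 else 3)"

definition inversions :: "4 set \<Rightarrow> 4 set \<Rightarrow> nat" where
  "inversions I J = card {(i, j). i \<in> I \<and> j \<in> J \<and> pos j < pos i}"

definition wedge :: "covector \<Rightarrow> covector \<Rightarrow> covector" (infixl \<open>\<and>\<^sub>e\<close> 70) where
  "u \<and>\<^sub>e v = (\<chi> K. \<Sum>I\<in>Pow K. (-1) ^ inversions I (K - I) * u$I * v$(K - I))"

lemma wedge_axis:
  "axis I 1 \<and>\<^sub>e axis J 1 =
     (if I \<inter> J = {} then (-1) ^ inversions I J *\<^sub>R axis (I \<union> J) 1 else 0)"
proof (rule vec_eq_iff[THEN iffD2, rule_format])
  fix K :: "4 set"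
  have "(axis I 1 \<and>\<^sub>e axis J 1) $ K =
      (\<Sum>L\<in>Pow K. if L = I \<and> K - I = J then (-1) ^ inversions I J else 0)"
    unfolding wedge_def by (auto simp: axis_def intro!: sum.cong)
  also have "\<dots> = (if I \<subseteq> K \<and> K - I = J then (-1) ^ inversions I J else 0)"
    by (cases "K - I = J") (simp_all add: sum.delta)
  also have "\<dots> = (if I \<inter> J = {} then (-1) ^ inversions I J *\<^sub>R axis (I \<union> J) 1 else 0) $ K"
    by (auto simp: axis_def)
  finally show "(axis I 1 \<and>\<^sub>e axis J 1) $ K =
      (if I \<inter> J = {} then (-1) ^ inversions I J *\<^sub>R axis (I \<union> J) 1 else 0) $ K" .
qed

definition one_form :: "4 \<Rightarrow> covector" (\<open>\<theta>\<close>) where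
  "\<theta> i = axis {i} 1"

definition d\<theta> :: "4 \<Rightarrow> covector" where
  "d\<theta> i = (if i = 3 then - (\<theta> 1 \<and>\<^sub>e \<theta> 2) else if i = 4 then - (\<theta> 1 \<and>\<^sub>e \<theta> 3) else 0)"

text \<open>
  The differential of a left-invariant form: by the Leibniz rule,
  \<open>d(\<theta> i\<^sub>1 \<and> \<dots> \<and> \<theta> i\<^sub>k)\<close> is the sum over \<open>j\<close> of
  \<open>(-1)^(j-1) \<theta> i\<^sub>1 \<and> \<dots> \<and> d\<theta> i\<^sub>j \<and> \<dots> \<and> \<theta> i\<^sub>k\<close>, in which the 2-form \<open>d\<theta> i\<^sub>j\<close> may
  be moved to the front.
\<close>

definition d_inv :: "covector \<Rightarrow> covector" where
  "d_inv \<xi> = (\<Sum>I\<in>UNIV. \<xi>$I *\<^sub>R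
     (\<Sum>i\<in>I. (-1) ^ card {j \<in> I. pos j < pos i} *\<^sub>R (d\<theta> i \<and>\<^sub>e axis (I - {i}) 1)))"

lemma inversions_empty: "inversions I {} = 0"
  by (simp add: inversions_def)

lemma wedge_one: "u \<and>\<^sub>e axis {} 1 = u"
proof (rule vec_eq_iff[THEN iffD2, rule_format])
  fix K :: "4 set"
  have "(u \<and>\<^sub>e axis {} 1) $ K = (\<Sum>I\<in>Pow K. if I = K then u $ K else 0)"
    unfolding wedge_def vec_lambda_beta
    by (intro sum.cong) (auto simp: axis_def inversions_empty)
  then show "(u \<and>\<^sub>e axis {} 1) $ K = u $ K"
    by simp
qed

lemma d_inv_axis:
  "d_inv (axis I 1) =
     (\<Sum>i\<in>I. (-1) ^ card {j \<in> I. pos j < pos i} *\<^sub>R (d\<theta> i \<and>\<^sub>e axis (I - {i}) 1))"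
proof -
  have "d_inv (axis I 1) = (\<Sum>J\<in>UNIV. if J = I then
      (\<Sum>i\<in>I. (-1) ^ card {j \<in> I. pos j < pos i} *\<^sub>R (d\<theta> i \<and>\<^sub>e axis (I - {i}) 1)) else 0)"
    unfolding d_inv_def by (intro sum.cong) (auto simp: axis_def)
  then show ?thesis
    by simp
qed

lemma d_inv_one_form: "d_inv (\<theta> i) = d\<theta> i"
proof -
  have empty: "(j = i \<and> pos j < pos i) = False" for j
    by auto
  show ?thesis
    by (simp add: one_form_def d_inv_axis wedge_one empty)
qed

definition Omega_c :: "int \<Rightarrow> int \<Rightarrow> form set" where
  "Omega_c p q = {\<omega>. (\<forall>I. (\<lambda>x. \<omega> x $ I) \<in> C_c_infinity) \<and>
     (\<forall>x I. \<omega> x $ I \<noteq> 0 \<longrightarrow> int (\<Sum>i\<in>I. weight i) = p \<and> int (card I) = p + q)}"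

definition of_fun :: "(engel \<Rightarrow> real) \<Rightarrow> form" where
  "of_fun f = (\<lambda>x. f x *\<^sub>R axis {} 1)"

definition d0 :: "form \<Rightarrow> form" where
  "d0 \<omega> = (\<lambda>x. d_inv (\<omega> x))"

definition d1 :: "form \<Rightarrow> form" where
  "d1 \<omega> = (\<lambda>x. \<theta> 1 \<and>\<^sub>e X 1 \<omega> x + \<theta> 2 \<and>\<^sub>e X 2 \<omega> x)"

definition d2 :: "form \<Rightarrow> form" where
  "d2 \<omega> = (\<lambda>x. \<theta> 3 \<and>\<^sub>e X 3 \<omega> x)"

text \<open>Here \<open>z2\<close> is a multiple of \<open>\<theta> 3\<close> and \<open>z3\<close> a multiple of \<open>\<theta> 4\<close>, both compactly supported.\<close>

definition Z3_10_c :: "form set" where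
  "Z3_10_c = {\<alpha> \<in> Omega_c 1 0. d0 \<alpha> = (\<lambda>x. 0) \<and>
     (\<exists>z2 \<in> Omega_c 2 (-1). \<exists>z3 \<in> Omega_c 3 (-2).
        d1 \<alpha> = d0 z2 \<and> d2 \<alpha> = (\<lambda>x. d0 z3 x + d1 z2 x))}"

end

theory Submission
  imports Defs
begin

text \<open>
  Every \<open>f1 \<theta>\<^sub>1 + f2 \<theta>\<^sub>2\<close> in \<open>Z\<^sub>3\<close> comes with \<open>h3 = X\<^sub>1 f2 - X\<^sub>2 f1\<close>,
  which satisfies \<open>X\<^sub>2 h3 = X\<^sub>3 f2\<close>; with \<open>h4 = X\<^sub>1 h3 - X\<^sub>3 f1\<close> the commutator
  relations give \<open>X\<^sub>2 h4 = X\<^sub>4 f2\<close>. Let \<open>f\<close> be the integral of \<open>f2\<close> along the flow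
  of \<open>X\<^sub>2\<close>, starting at time \<open>-\<infinity>\<close>. This flow preserves \<open>X\<^sub>2\<close>, \<open>X\<^sub>3\<close>, \<open>X\<^sub>4\<close> and
  transports \<open>X\<^sub>1\<close> to \<open>X\<^sub>1 + t X\<^sub>3\<close>. After differentiation under the integral the
  relations turn the integrands into exact derivatives in \<open>t\<close>, so \<open>X\<^sub>i f\<close> equals
  \<open>f1\<close>, \<open>f2\<close>, \<open>h3\<close>, \<open>h4\<close> for \<open>i = 1, 2, 3, 4\<close>. Hence \<open>f\<close> is smooth and locally
  constant outside a ball. The complement of the ball is connected and contains points where
  \<open>f\<close> vanishes, so \<open>f\<close> has compact support.
\<close>

section \<open>Smooth functions\<close>

abbreviation dir_deriv :: "'a \<Rightarrow> ('a::real_normed_vector \<Rightarrow> 'b::real_normed_vector) \<Rightarrow> 'a \<Rightarrow> 'b" where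
  "dir_deriv v F \<equiv> \<lambda>x. frechet_derivative F (at x) v"

lemma has_derivative_dir_deriv:
  "f differentiable (at x) \<Longrightarrow> (f has_derivative (\<lambda>v. dir_deriv v f x)) (at x)"
  by (simp add: frechet_derivative_works)

lemma dir_deriv_eq: "(f has_derivative f') (at x) \<Longrightarrow> dir_deriv v f x = f' v"
  by (simp flip: frechet_derivative_at)

lemma times_cont_diff_SucD: "times_cont_diff (Suc n) f \<Longrightarrow> times_cont_diff n f"
proof (induction n arbitrary: f)
  case 0
  then show ?case
    by (auto simp: continuous_on_eq_continuous_at intro: differentiable_imp_continuous_within)
next
  case (Suc n)
  then show ?case by (metis times_cont_diff.simps(2))
qed

text \<open>Smoothness unfolded by one derivative, so that later proofs need no induction over the
  order. From right to left the recursion only yields the orders \<open>Suc n\<close>; order 0 comes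
  from \<open>times_cont_diff_SucD\<close>.\<close>

lemma smooth_iff: "smooth f \<longleftrightarrow> (\<forall>x. f differentiable (at x)) \<and> (\<forall>v. smooth (dir_deriv v f))"
proof
  assume "smooth f"
  then have "times_cont_diff (Suc n) f" for n
    by (simp add: smooth_def del: times_cont_diff.simps)
  then show "(\<forall>x. f differentiable (at x)) \<and> (\<forall>v. smooth (dir_deriv v f))"
    by (auto simp: smooth_def)
next
  assume "(\<forall>x. f differentiable (at x)) \<and> (\<forall>v. smooth (dir_deriv v f))"
  then have "times_cont_diff (Suc n) f" for n
    by (simp add: smooth_def)
  then show "smooth f"
    using times_cont_diff_SucD by (auto simp: smooth_def simp del: times_cont_diff.simps)
qed

lemma smooth_imp_differentiable: "smooth f \<Longrightarrow> f differentiable (at x)"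
  and smooth_dir_deriv: "smooth f \<Longrightarrow> smooth (dir_deriv v f)"
  using smooth_iff by auto

lemma smooth_has_derivative:
  "smooth f \<Longrightarrow> (f has_derivative (\<lambda>v. dir_deriv v f x)) (at x)"
  by (intro has_derivative_dir_deriv smooth_imp_differentiable)

lemma smooth_continuous_on: "smooth f \<Longrightarrow> continuous_on S f"
  by (meson smooth_def times_cont_diff.simps(1) continuous_on_subset subset_UNIV)

section \<open>Sums and products of smooth functions, and symmetry of second derivatives\<close>

lemma times_cont_diff_const: "times_cont_diff n (\<lambda>x. c)"
  by (induction n arbitrary: c) simp_all

lemma smooth_const: "smooth (\<lambda>x. c)"
  by (simp add: smooth_def times_cont_diff_const)

lemma smooth_linear:
  assumes "bounded_linear f"
  shows "smooth f"
proof -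
  have "dir_deriv v f = (\<lambda>x. f v)" for v
    using bounded_linear_imp_has_derivative[OF assms] by (auto dest: dir_deriv_eq)
  with assms show ?thesis
    unfolding smooth_iff[of f] by (auto intro: bounded_linear_imp_differentiable smooth_const)
qed

lemma times_cont_diff_add:
  "times_cont_diff n f \<Longrightarrow> times_cont_diff n g \<Longrightarrow> times_cont_diff n (\<lambda>x. f x + g x)"
proof (induction n arbitrary: f g)
  case 0
  then show ?case by (simp add: continuous_on_add)
next
  case (Suc n)
  from Suc.prems have "((\<lambda>x. f x + g x) has_derivative (\<lambda>v. dir_deriv v f x + dir_deriv v g x)) (at x)" for x
    by (intro has_derivative_add) (simp_all add: has_derivative_dir_deriv)
  then have "dir_deriv v (\<lambda>x. f x + g x) = (\<lambda>x. dir_deriv v f x + dir_deriv v g x)" for v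
    by (auto dest: dir_deriv_eq)
  with Suc.prems show ?case by (auto intro!: differentiable_add Suc.IH)
qed

lemma times_cont_diff_mult:
  fixes f g :: "'a::real_normed_vector \<Rightarrow> 'b::real_normed_algebra"
  shows "times_cont_diff n f \<Longrightarrow> times_cont_diff n g \<Longrightarrow> times_cont_diff n (\<lambda>x. f x * g x)"
proof (induction n arbitrary: f g)
  case 0
  then show ?case by (simp add: continuous_on_mult)
next
  case (Suc n)
  from Suc.prems have "((\<lambda>x. f x * g x) has_derivative
      (\<lambda>v. f x * dir_deriv v g x + dir_deriv v f x * g x)) (at x)" for x
    by (intro has_derivative_mult) (simp_all add: has_derivative_dir_deriv)
  then have "dir_deriv v (\<lambda>x. f x * g x) = (\<lambda>x. f x * dir_deriv v g x + dir_deriv v f x * g x)" for v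
    by (auto dest: dir_deriv_eq)
  \<comment> \<open>The product rule leaves one factor undifferentiated, so the induction hypothesis
    also needs \<open>f\<close> and \<open>g\<close> at the lower order.\<close>
  moreover from Suc.prems have "times_cont_diff n f" "times_cont_diff n g"
    by (blast intro: times_cont_diff_SucD)+
  ultimately show ?case
    using Suc.prems by (auto intro!: differentiable_mult times_cont_diff_add Suc.IH)
qed

lemma smooth_add: "smooth f \<Longrightarrow> smooth g \<Longrightarrow> smooth (\<lambda>x. f x + g x)"
  by (simp add: smooth_def times_cont_diff_add)

lemma smooth_mult:
  fixes f g :: "'a::real_normed_vector \<Rightarrow> 'b::real_normed_algebra"
  shows "smooth f \<Longrightarrow> smooth g \<Longrightarrow> smooth (\<lambda>x. f x * g x)"
  by (simp add: smooth_def times_cont_diff_mult)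

text \<open>An increment of \<open>F\<close> along \<open>w\<close> is the integral of its
  \<open>w\<close>-derivative. Differentiating this under the integral along \<open>v\<close>, and
  then in the length \<open>s\<close> of the increment at 0, gives both orders of
  differentiation.\<close>

lemma dir_deriv_commute:
  fixes F :: "'a::real_normed_vector \<Rightarrow> 'b::euclidean_space"
  assumes F: "smooth F"
  shows "dir_deriv w (dir_deriv v F) x = dir_deriv v (dir_deriv w F) x"
proof -
  have line: "((\<lambda>s. H (p + s *\<^sub>R u)) has_vector_derivative dir_deriv u H (p + s *\<^sub>R u)) (at s within S)"
    if "smooth H" for H :: "'a \<Rightarrow> 'b" and p u s S
  proof -
    have "((\<lambda>s. p + s *\<^sub>R u) has_derivative (\<lambda>h. h *\<^sub>R u)) (at s within S)"
      by (auto intro!: derivative_eq_intros)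
    from has_derivative_compose[OF this smooth_has_derivative[OF that]]
    show ?thesis
      using linear_frechet_derivative[OF smooth_imp_differentiable[OF that]]
      by (simp add: has_vector_derivative_def linear_cmul)
  qed
  have 1: "F (p + s *\<^sub>R w) - F p = integral (cbox 0 s) (\<lambda>t. dir_deriv w F (p + t *\<^sub>R w))" if "0 \<le> s" for s p
    using fundamental_theorem_of_calculus[OF that line[OF F, of p w]]
    by (auto dest!: integral_unique simp: cbox_interval)
  have sm: "smooth (dir_deriv v (dir_deriv w F))" "smooth (dir_deriv w F)" "smooth (dir_deriv v F)"
    using F by (auto intro: smooth_dir_deriv)
  have cont: "continuous_on T (\<lambda>r. H (g r))" if "smooth H" "continuous_on T g" for H :: "'a \<Rightarrow> 'b" and T
      and g :: "'c::topological_space \<Rightarrow> 'a"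
    using continuous_on_compose2[OF smooth_continuous_on[OF that(1), of UNIV] that(2)] by simp
  \<comment> \<open>Both sides are the derivative at \<open>r = 0\<close> of F(x + s w + r v) - F(x
    + r v), computed once directly and once through the integral in \<open>1\<close>.\<close>
  have 2: "dir_deriv v F (x + s *\<^sub>R w) - dir_deriv v F x =
      integral {0..s} (\<lambda>t. dir_deriv v (dir_deriv w F) (x + t *\<^sub>R w))" if "0 \<le> s" for s
  proof -
    have "((\<lambda>r. integral (cbox 0 s) (\<lambda>t. dir_deriv w F (x + t *\<^sub>R w + r *\<^sub>R v))) has_vector_derivative
       integral (cbox 0 s) (\<lambda>t. dir_deriv v (dir_deriv w F) (x + t *\<^sub>R w + 0 *\<^sub>R v))) (at 0 within UNIV)"
      by (rule leibniz_rule_vector_derivative[where f = "\<lambda>r t. dir_deriv w F (x + t *\<^sub>R w + r *\<^sub>R v)" and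
            fx = "\<lambda>r t. dir_deriv v (dir_deriv w F) (x + t *\<^sub>R w + r *\<^sub>R v)"])
        (auto intro!: line sm integrable_continuous_interval cont continuous_intros simp: split_beta)
    moreover have "((\<lambda>r. F ((x + s *\<^sub>R w) + r *\<^sub>R v) - F (x + r *\<^sub>R v)) has_vector_derivative
        dir_deriv v F (x + s *\<^sub>R w + 0 *\<^sub>R v) - dir_deriv v F (x + 0 *\<^sub>R v)) (at 0)"
      by (intro has_vector_derivative_diff line F)
    moreover have "F ((x + s *\<^sub>R w) + r *\<^sub>R v) - F (x + r *\<^sub>R v) =
        integral (cbox 0 s) (\<lambda>t. dir_deriv w F (x + t *\<^sub>R w + r *\<^sub>R v))" for r
      using 1[OF that, of "x + r *\<^sub>R v"] by (simp add: algebra_simps)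
    ultimately show ?thesis
      using vector_derivative_unique_at by (fastforce simp: cbox_interval)
  qed
  \<comment> \<open>Since \<open>2\<close> is available for nonnegative \<open>s\<close>, the
    derivatives at 0 are taken within \<open>{0..1}\<close>, where they are still unique.\<close>
  have "((\<lambda>s. integral {0..s} (\<lambda>t. dir_deriv v (dir_deriv w F) (x + t *\<^sub>R w))) has_vector_derivative
      dir_deriv v (dir_deriv w F) (x + 0 *\<^sub>R w)) (at 0 within {0..1::real})"
    by (intro integral_has_vector_derivative cont sm continuous_intros) auto
  moreover have "((\<lambda>s. dir_deriv v F (x + s *\<^sub>R w) - dir_deriv v F x) has_vector_derivative
      dir_deriv w (dir_deriv v F) (x + 0 *\<^sub>R w) - 0) (at 0 within {0..1::real})"
    by (intro has_vector_derivative_diff line sm has_vector_derivative_const)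
  then have "((\<lambda>s. integral {0..s} (\<lambda>t. dir_deriv v (dir_deriv w F) (x + t *\<^sub>R w))) has_vector_derivative
      dir_deriv w (dir_deriv v F) (x + 0 *\<^sub>R w) - 0) (at 0 within {0..1::real})"
    by (rule has_vector_derivative_transform[rotated 2]) (simp_all add: 2)
  ultimately show ?thesis
    using vector_derivative_unique_within_closed_interval[of 0 1 0] by fastforce
qed

text \<open>Subtraction is reduced to multiplication by the constant -1, hence the target is an
  algebra with unit.\<close>

lemma smooth_diff:
  fixes f g :: "'a::real_normed_vector \<Rightarrow> 'b::real_normed_algebra_1"
  shows "smooth f \<Longrightarrow> smooth g \<Longrightarrow> smooth (\<lambda>x. f x - g x)"
  using smooth_add[OF _ smooth_mult[OF smooth_const[of "-1"]], of f g] by simp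

lemma smooth_minus:
  fixes f :: "'a::real_normed_vector \<Rightarrow> 'b::real_normed_algebra_1"
  shows "smooth f \<Longrightarrow> smooth (\<lambda>x. - f x)"
  using smooth_diff[OF smooth_const[of 0]] by simp

lemma smooth_divide_const:
  fixes f :: "'a::real_normed_vector \<Rightarrow> 'b::real_normed_field"
  shows "smooth f \<Longrightarrow> smooth (\<lambda>x. f x / c)"
  using smooth_mult[OF _ smooth_const[of "inverse c"]] by (simp add: divide_inverse)

lemma smooth_nth: "smooth (\<lambda>x::real^'n. x $ i)"
  by (intro smooth_linear bounded_linear_vec_nth)

lemmas smooth_intros = smooth_const smooth_nth smooth_add smooth_diff smooth_minus smooth_mult
  smooth_divide_const smooth_dir_deriv

section \<open>Left-invariant vector fields\<close>

text \<open>The value of \<open>X i\<close> at \<open>x\<close>, namely \<open>ad x / (1 - exp (- ad x))\<close> applied to \<open>axis i 1\<close>.\<close>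

definition frame :: "4 \<Rightarrow> engel \<Rightarrow> engel" where
  "frame i x = axis i 1 + (1/2) *\<^sub>R lie_bracket x (axis i 1)
     + (1/12) *\<^sub>R lie_bracket x (lie_bracket x (axis i 1))"

lemma X_eq_dir_deriv:
  assumes "F differentiable (at x)"
  shows "X i F x = dir_deriv (frame i x) F x"
proof -
  have "X 1 F x = dir_deriv (frame 1 x) F x" "X 2 F x = dir_deriv (frame 2 x) F x"
    "X 3 F x = dir_deriv (frame 3 x) F x" "X 4 F x = dir_deriv (frame 4 x) F x"
    unfolding X_eq_frechet_derivative[OF assms]
    by (rule arg_cong[where f = "frechet_derivative F (at x)"],
        simp add: vec4_eq_iff frame_def axis_def power2_eq_square field_simps)+
  then show ?thesis
    using exhaust_4[of i] by auto
qed

lemma X_eq: "(F has_derivative F') (at x) \<Longrightarrow> X i F x = F' (frame i x)"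
  by (simp add: X_eq_dir_deriv differentiableI dir_deriv_eq)

lemma vec4_expand: "v = v$1 *\<^sub>R axis 1 1 + v$2 *\<^sub>R axis 2 1 + v$3 *\<^sub>R axis 3 1 + v$4 *\<^sub>R axis 4 1"
  for v :: engel
  by (simp add: vec4_eq_iff axis_def)

lemma dir_deriv_expand:
  fixes v :: engel
  assumes "F differentiable (at x)"
  shows "dir_deriv v F x = v$1 *\<^sub>R dir_deriv (axis 1 1) F x + v$2 *\<^sub>R dir_deriv (axis 2 1) F x
    + v$3 *\<^sub>R dir_deriv (axis 3 1) F x + v$4 *\<^sub>R dir_deriv (axis 4 1) F x"
  using linear_frechet_derivative[OF assms]
  by (subst vec4_expand[of v]) (simp only: linear_add linear_cmul)

text \<open>Constant directions put the dependence of the field on the point into polynomial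
  coefficients. Smoothness of \<open>X i F\<close> and the second order computations rest on this
  form.\<close>

lemma X_expand:
  fixes F :: "engel \<Rightarrow> real"
  assumes "smooth F"
  shows "X i F = (\<lambda>x. frame i x $ 1 * dir_deriv (axis 1 1) F x + frame i x $ 2 * dir_deriv (axis 2 1) F x
    + frame i x $ 3 * dir_deriv (axis 3 1) F x + frame i x $ 4 * dir_deriv (axis 4 1) F x)"
proof
  fix x
  show "X i F x = frame i x $ 1 * dir_deriv (axis 1 1) F x + frame i x $ 2 * dir_deriv (axis 2 1) F x
    + frame i x $ 3 * dir_deriv (axis 3 1) F x + frame i x $ 4 * dir_deriv (axis 4 1) F x"
    using dir_deriv_expand[OF smooth_imp_differentiable[OF assms], where v = "frame i x" and x = x]
    by (simp add: X_eq_dir_deriv[OF smooth_imp_differentiable[OF assms]])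
qed

lemma frame_nth:
  "frame i x $ 1 = axis i 1 $ 1" "frame i x $ 2 = axis i 1 $ 2"
  "frame i x $ 3 = axis i 1 $ 3 + (x$1 * axis i 1 $ 2 - x$2 * axis i 1 $ 1) / 2"
  "frame i x $ 4 = axis i 1 $ 4 + (x$1 * axis i 1 $ 3 - x$3 * axis i 1 $ 1) / 2
     + x$1 * (x$1 * axis i 1 $ 2 - x$2 * axis i 1 $ 1) / 12"
  by (simp_all add: frame_def)

lemma smooth_X:
  fixes F :: "engel \<Rightarrow> real"
  shows "smooth F \<Longrightarrow> smooth (X i F)"
  unfolding X_expand frame_nth by (intro smooth_intros)

lemma X_add:
  fixes F G :: "engel \<Rightarrow> real"
  assumes "smooth F" "smooth G"
  shows "X i (\<lambda>x. F x + G x) x = X i F x + X i G x"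
  using X_eq[OF has_derivative_add[OF assms[THEN smooth_has_derivative]]] assms
  by (simp add: X_eq_dir_deriv smooth_imp_differentiable)

lemma X_diff:
  fixes F G :: "engel \<Rightarrow> real"
  assumes "smooth F" "smooth G"
  shows "X i (\<lambda>x. F x - G x) x = X i F x - X i G x"
  using X_eq[OF has_derivative_diff[OF assms[THEN smooth_has_derivative]]] assms
  by (simp add: X_eq_dir_deriv smooth_imp_differentiable)

lemma X_minus:
  fixes F :: "engel \<Rightarrow> real"
  assumes "smooth F"
  shows "X i (\<lambda>x. - F x) x = - X i F x"
  using X_eq[OF has_derivative_minus[OF assms[THEN smooth_has_derivative]]] assms
  by (simp add: X_eq_dir_deriv smooth_imp_differentiable)

lemma X_mult:
  fixes F G :: "engel \<Rightarrow> real"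
  assumes "smooth F" "smooth G"
  shows "X i (\<lambda>x. F x * G x) x = F x * X i G x + X i F x * G x"
  using X_eq[OF has_derivative_mult[OF assms[THEN smooth_has_derivative]]] assms
  by (simp add: X_eq_dir_deriv smooth_imp_differentiable)

section \<open>Commutators of the left-invariant fields\<close>

lemma X_frame_nth:
  "X j (\<lambda>x. frame i x $ k) x =
    (if k = 3 then (frame j x $ 1 * axis i 1 $ 2 - frame j x $ 2 * axis i 1 $ 1) / 2
     else if k = 4 then (frame j x $ 1 * axis i 1 $ 3 - frame j x $ 3 * axis i 1 $ 1) / 2
     + (2 * frame j x $ 1 * x$1 * axis i 1 $ 2
        - (frame j x $ 1 * x$2 + x$1 * frame j x $ 2) * axis i 1 $ 1) / 12 else 0)"
proof -
  note nth = bounded_linear_imp_has_derivative[OF bounded_linear_vec_nth]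
  have "((\<lambda>x. frame i x $ 3) has_derivative (\<lambda>v. (v$1 * axis i 1 $ 2 - v$2 * axis i 1 $ 1) / 2)) (at x)"
    unfolding frame_nth by (auto intro!: derivative_eq_intros nth)
  moreover have "((\<lambda>x. frame i x $ 4) has_derivative (\<lambda>v. (v$1 * axis i 1 $ 3 - v$3 * axis i 1 $ 1) / 2
     + (2 * v$1 * x$1 * axis i 1 $ 2 - (v$1 * x$2 + x$1 * v$2) * axis i 1 $ 1) / 12)) (at x)"
    unfolding frame_nth by (auto intro!: derivative_eq_intros nth simp: field_simps)
  moreover have "((\<lambda>x. frame i x $ k) has_derivative (\<lambda>v. 0)) (at x)" if "k = 1 \<or> k = 2"
    using that by (auto simp: frame_nth)
  ultimately show ?thesis
    using exhaust_4[of k] by (auto simp: X_eq)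
qed

text \<open>The Leibniz rule separates a first order part, in which the coefficients are
  differentiated, from a second order part, which is symmetric in \<open>i\<close> and
  \<open>j\<close> once mixed derivatives commute.\<close>

lemma X_X:
  fixes F :: "engel \<Rightarrow> real"
  assumes "smooth F"
  shows "X j (X i F) x = (\<Sum>k\<in>UNIV. X j (\<lambda>x. frame i x $ k) x * dir_deriv (axis k 1) F x
     + frame i x $ k * (\<Sum>l\<in>UNIV. frame j x $ l * dir_deriv (axis l 1) (dir_deriv (axis k 1) F) x))"
proof -
  have [simp]: "smooth (\<lambda>x. frame i x $ k)" for i k
    using exhaust_4[of k] by (auto simp: frame_nth intro!: smooth_intros)
  have [simp]: "smooth (dir_deriv v F)" for v
    using assms by (rule smooth_dir_deriv)
  have "X j (dir_deriv (axis k 1) F) x =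
      (\<Sum>l\<in>UNIV. frame j x $ l * dir_deriv (axis l 1) (dir_deriv (axis k 1) F) x)" for k
    by (simp add: X_expand sum_4)
  then show ?thesis
    unfolding X_expand[OF assms, of i] by (simp add: X_add X_mult smooth_intros sum_4)
qed

text \<open>These are the brackets of the Lie algebra as operators. The second order parts of
  \<open>X_X\<close> cancel, and the first order parts reduce to polynomial identities for the
  coefficients of \<open>frame\<close>.\<close>

lemma X_commute:
  fixes F :: "engel \<Rightarrow> real"
  assumes "smooth F"
  shows "X 1 (X 2 F) x - X 2 (X 1 F) x = X 3 F x"
    and "X 1 (X 3 F) x - X 3 (X 1 F) x = X 4 F x"
    and "X 2 (X 3 F) x = X 3 (X 2 F) x"
proof -
  have comm: "dir_deriv (axis l 1) (dir_deriv (axis k 1) F) x =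
      dir_deriv (axis k 1) (dir_deriv (axis l 1) F) x" for k l
    using assms by (rule dir_deriv_commute)
  have axis_nth: "axis i 1 $ k = (if k = i then 1 else 0)" for i k :: 4
    by (simp add: axis_def)
  \<comment> \<open>Each pair of distinct indices occurs in one orientation, so rewriting brings
    mixed derivatives to a fixed order and terminates.\<close>
  note simps = X_expand[OF assms] sum_4 X_frame_nth frame_nth axis_nth
    comm[of 1 2] comm[of 1 3] comm[of 1 4] comm[of 2 3] comm[of 2 4] comm[of 3 4]
  show "X 1 (X 2 F) x - X 2 (X 1 F) x = X 3 F x"
    unfolding X_X[OF assms] by (simp add: simps field_simps)
  show "X 1 (X 3 F) x - X 3 (X 1 F) x = X 4 F x"
    unfolding X_X[OF assms] by (simp add: simps field_simps)
  show "X 2 (X 3 F) x = X 3 (X 2 F) x"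
    unfolding X_X[OF assms] by (simp add: simps field_simps)
qed

section \<open>Compactly supported potentials\<close>

text \<open>By Heine-Borel the closure of the nonzero set is compact exactly if that set is
  bounded.\<close>

lemma C_c_infinity_iff:
  "f \<in> C_c_infinity \<longleftrightarrow> smooth f \<and> (\<exists>R. \<forall>x. R < norm x \<longrightarrow> f x = 0)"
proof -
  have "(\<forall>x. R < norm x \<longrightarrow> f x = 0) \<longleftrightarrow> (\<forall>x\<in>{x. f x \<noteq> 0}. norm x \<le> R)" for R
    by (auto simp: not_le[symmetric])
  then show ?thesis
    by (simp add: C_c_infinity_def bounded_iff)
qed

lemma X_eq_0_outside:
  fixes f :: "engel \<Rightarrow> real"
  assumes "\<And>x. R < norm x \<Longrightarrow> f x = 0" "R < norm x"
  shows "X i f x = 0"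
proof (rule X_eq)
  have "open {x::engel. R < norm x}"
    by (intro open_Collect_less continuous_intros)
  then show "(f has_derivative (\<lambda>v. 0)) (at x)"
    using assms by (intro has_derivative_transform_within_open[OF has_derivative_const]) auto
qed

lemma C_c_infinity_X: "f \<in> C_c_infinity \<Longrightarrow> X i f \<in> C_c_infinity"
  unfolding C_c_infinity_iff using X_eq_0_outside smooth_X by metis

lemma C_c_infinity_minus: "f \<in> C_c_infinity \<Longrightarrow> (\<lambda>x. - f x) \<in> C_c_infinity"
  unfolding C_c_infinity_iff by (auto intro: smooth_minus)

lemma C_c_infinity_0: "(\<lambda>x. 0) \<in> C_c_infinity"
  by (simp add: C_c_infinity_iff smooth_const)

section \<open>The flow of \<open>X 2\<close>, that is, right translation along its one-parameter
  subgroup\<close>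

definition flow :: "real \<Rightarrow> engel \<Rightarrow> engel" where
  "flow t x = x \<odot> (t *\<^sub>R axis 2 1)"

lemma flow_eq:
  "flow t x = x + t *\<^sub>R (axis 2 1 + (x$1 / 2) *\<^sub>R axis 3 1 + ((x$1)\<^sup>2 / 12) *\<^sub>R axis 4 1)"
  by (simp add: flow_def engel_mult_def vec4_eq_iff axis_def power2_eq_square field_simps)

lemma flow_nth: "flow t x $ 1 = x $ 1" "flow t x $ 2 = x $ 2 + t"
  by (simp_all add: flow_eq axis_def)

lemma flow_0: "flow 0 x = x"
  by (simp add: flow_eq)

definition flow_deriv :: "real \<Rightarrow> engel \<Rightarrow> engel \<Rightarrow> engel" where
  "flow_deriv t x w = w + (t * w$1) *\<^sub>R ((1/2) *\<^sub>R axis 3 1 + (x$1 / 6) *\<^sub>R axis 4 1)"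

lemma has_derivative_flow: "(flow t has_derivative flow_deriv t x) (at x within S)"
  unfolding flow_eq[abs_def] flow_deriv_def[abs_def]
  by (auto intro!: derivative_eq_intros bounded_linear_imp_has_derivative[OF bounded_linear_vec_nth]
      simp: vec4_eq_iff axis_def)

lemma has_vector_derivative_flow:
  "((\<lambda>t. flow t x) has_vector_derivative frame 2 (flow t x)) (at t within S)"
proof -
  have "frame 2 (flow t x) = axis 2 1 + (x$1 / 2) *\<^sub>R axis 3 1 + ((x$1)\<^sup>2 / 12) *\<^sub>R axis 4 1"
    by (simp add: vec4_eq_iff frame_nth flow_nth axis_def power2_eq_square)
  then show ?thesis
    unfolding flow_eq[abs_def] by (auto intro!: derivative_eq_intros)
qed

text \<open>Right translation by exp(t X_2) acts on left-invariant fields by Ad(exp(-t X_2)). It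
  fixes X_2, X_3 and X_4. As [X_2, X_1] = -X_3 commutes with X_2, the series for X_1 stops at X_1 +
  t X_3.\<close>

lemma flow_deriv_frame:
  "flow_deriv t x (frame i x) = frame i (flow t x) + (if i = 1 then t else 0) *\<^sub>R frame 3 (flow t x)"
  using exhaust_4[of i]
  by (auto simp: flow_deriv_def vec4_eq_iff frame_nth flow_eq axis_def power2_eq_square field_simps)

text \<open>Along its own flow \<open>X 2\<close> is the derivative in time, which makes the
  fundamental theorem of calculus applicable to integrands \<open>X 2 h\<close>.\<close>

lemma X_2_flow:
  assumes "smooth (h :: engel \<Rightarrow> real)"
  shows "((\<lambda>t. h (flow t x)) has_vector_derivative X 2 h (flow t x)) (at t within S)"
  using vector_derivative_diff_chain_within[OF has_vector_derivative_flow
      has_derivative_at_withinI[OF smooth_has_derivative[OF assms]]]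
  by (simp add: o_def X_eq_dir_deriv smooth_imp_differentiable assms)

lemma continuous_on_flow:
  assumes "continuous_on S f" "continuous_on S g"
  shows "continuous_on S (\<lambda>x. flow (f x) (g x))"
  unfolding flow_eq by (intro continuous_intros assms) auto

text \<open>Differentiation under the integral over a compact time interval. The Leibniz rule asks
  for a jointly continuous family of bounded linear maps, hence the packaging of the derivatives as
  \<open>A\<close>.\<close>

lemma has_derivative_flow_integral:
  assumes g: "smooth (g :: engel \<Rightarrow> real)"
  shows "((\<lambda>x. integral {-K..0} (\<lambda>t. g (flow t x))) has_derivative
    (\<lambda>w. integral {-K..0} (\<lambda>t. dir_deriv (flow_deriv t x w) g (flow t x)))) (at x)"
proof -
  define A where "A x t = Blinfun (\<lambda>w. dir_deriv (flow_deriv t x w) g (flow t x))" for x t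
  have deriv: "((\<lambda>x. g (flow t x)) has_derivative
      (\<lambda>w. dir_deriv (flow_deriv t x w) g (flow t x))) (at x)" for t x
    by (rule has_derivative_compose[OF has_derivative_flow smooth_has_derivative[OF g]])
  have A: "blinfun_apply (A x t) = (\<lambda>w. dir_deriv (flow_deriv t x w) g (flow t x))" for x t
    unfolding A_def using deriv by (intro bounded_linear_Blinfun_apply has_derivative_bounded_linear)
  have cont: "continuous_on T (\<lambda>p. h (u p))" if "smooth h" "continuous_on T u"
    for h :: "engel \<Rightarrow> real" and T and u :: "'c::topological_space \<Rightarrow> engel"
    using continuous_on_compose2[OF smooth_continuous_on[OF that(1), of UNIV] that(2)] by simp
  have contA: "continuous_on T (\<lambda>p. A (fst p) (snd p))" for T
  \<comment> \<open>In finite dimension continuity in operator norm can be tested on vectors.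
    Expanding in constant directions then leaves products of continuous coefficients with continuous
    partial derivatives.\<close>
  proof (rule continuous_on_blinfun_componentwise)
    fix w :: engel
    show "continuous_on T (\<lambda>p. blinfun_apply (A (fst p) (snd p)) w)"
      unfolding A
      by (subst dir_deriv_expand[OF smooth_imp_differentiable[OF g]])
        (auto simp: flow_deriv_def intro!: continuous_intros cont smooth_intros g continuous_on_flow)
  qed
  have "((\<lambda>x. integral (cbox (-K) 0) (\<lambda>t. g (flow t x))) has_derivative
      integral (cbox (-K) 0) (A x)) (at x within UNIV)"
    using contA
    by (intro leibniz_rule)
      (auto simp: A split_beta
        intro!: deriv integrable_continuous_interval cont g continuous_on_flow continuous_intros)
  moreover have "A x integrable_on {-K..0}"
  proof -
    have "continuous_on {-K..0} (Pair x)"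
      by (intro continuous_intros)
    from continuous_on_compose2[OF contA[of UNIV] this] show ?thesis
      by (simp add: integrable_continuous_interval)
  qed
  then have "blinfun_apply (integral {-K..0} (A x)) =
      (\<lambda>w. integral {-K..0} (\<lambda>t. dir_deriv (flow_deriv t x w) g (flow t x)))"
    by (simp add: fun_eq_iff blinfun_apply_integral A)
  ultimately show ?thesis
    by (simp add: cbox_interval)
qed

section \<open>Recovering all derivatives from those along the left-invariant frame\<close>

lemma dir_deriv_frame_expand:
  fixes v x :: engel
  defines "c3 \<equiv> v$3 - v$1 * frame 1 x $ 3 - v$2 * frame 2 x $ 3"
  assumes "f differentiable (at x)"
  shows "dir_deriv v f x = v$1 *\<^sub>R X 1 f x + v$2 *\<^sub>R X 2 f x + c3 *\<^sub>R X 3 f x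
    + (v$4 - v$1 * frame 1 x $ 4 - v$2 * frame 2 x $ 4 - c3 * frame 3 x $ 4) *\<^sub>R X 4 f x"
    (is "_ = _ + ?c4 *\<^sub>R _")
proof -
  \<comment> \<open>The frame is triangular with unit diagonal, so its coefficients follow by
    forward substitution: \<open>c3\<close> corrects the third component and \<open>?c4\<close> the
    fourth.\<close>
  have v: "v = v$1 *\<^sub>R frame 1 x + v$2 *\<^sub>R frame 2 x + c3 *\<^sub>R frame 3 x + ?c4 *\<^sub>R frame 4 x"
    by (simp add: vec4_eq_iff c3_def) (simp add: frame_nth axis_def)
  show ?thesis
    unfolding X_eq_dir_deriv[OF assms(2)]
    using linear_frechet_derivative[OF assms(2)]
    by (subst v) (simp only: linear_add linear_cmul)
qed

text \<open>Derivatives in constant directions are combinations of the \<open>X i f\<close> with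
  polynomial coefficients.\<close>

lemma smooth_if_smooth_X:
  fixes f :: "engel \<Rightarrow> real"
  assumes diff: "\<And>x. f differentiable (at x)" and X: "\<And>i. smooth (X i f)"
  shows "smooth f"
  unfolding smooth_iff[of f]
proof (intro conjI allI diff)
  fix v :: engel
  have "smooth (\<lambda>x. frame i x $ k)" for i k
    using exhaust_4[of k] by (auto simp: frame_nth intro!: smooth_intros)
  then show "smooth (dir_deriv v f)"
    unfolding dir_deriv_frame_expand[OF diff] real_scaleR_def by (intro smooth_intros X)
qed

lemma has_derivative_0_if_X_0:
  assumes "f differentiable (at x)" "\<And>i. X i f x = 0"
  shows "(f has_derivative (\<lambda>v. 0)) (at x)"
  using has_derivative_dir_deriv[OF assms(1)] dir_deriv_frame_expand[OF assms(1)]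
  by (simp add: assms(2))

text \<open>The hypothesis \<open>closed\<close> expresses that d(\<Sum> h_i \<theta>_i) vanishes on
  the pairs (X_i, X_2), where \<open>h 3\<close> stems from [X_1, X_2] = X_3. Integration of
  \<open>h 2\<close> along the flow of X_2 turns these equations into
  \<open>X i f = h i\<close>.\<close>

lemma compactly_supported_potential:
  fixes h :: "4 \<Rightarrow> engel \<Rightarrow> real"
  assumes C_c: "\<And>i. h i \<in> C_c_infinity"
    and closed: "\<And>i x. X i (h 2) x = X 2 (h i) x + (if i = 1 then h 3 x else 0)"
  obtains f where "f \<in> C_c_infinity" "\<And>i. X i f = h i"
proof -
  have "\<forall>i. \<exists>R. \<forall>x. R < norm x \<longrightarrow> h i x = 0"
    using C_c by (simp add: C_c_infinity_iff)
  then obtain r where r: "\<And>i x. r i < norm x \<Longrightarrow> h i x = 0"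
    by metis
  define R where "R = Max (range r)"
  have R: "h i x = 0" if "R < norm x" for i x
    using that by (intro r) (auto simp: R_def)
  have R2: "h i x = 0" if "x $ 2 < - R" for i x
    using that component_le_norm_cart[of x 2] by (intro R) linarith
  have sm: "smooth (h i)" for i
    using C_c by (simp add: C_c_infinity_iff)
  define f where "f x = integral {..0} (\<lambda>t. h 2 (flow t x))" for x
  define F where "F K x = integral {-K..0} (\<lambda>t. h 2 (flow t x))" for K x
  \<comment> \<open>The flow moves the second coordinate with unit speed, so before time
    \<open>-K\<close> it is below \<open>-R\<close> and the integrand vanishes. The same
    \<open>K\<close> serves a whole open half-space, on which \<open>f\<close> inherits the
    derivative of \<open>F K\<close>.\<close>
  have f_eq_F: "f x = F K x" if "x $ 2 < K - R" for x K
  proof -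
    have "F K x = integral {..0} (\<lambda>t. if t \<in> {-K..0} then h 2 (flow t x) else 0)"
      unfolding F_def by (subst integral_restrict_Int) (simp add: Int_absorb2 subset_eq)
    also have "\<dots> = f x"
      unfolding f_def using that by (intro integral_cong) (auto simp: flow_nth intro!: R2)
    finally show ?thesis ..
  qed
  have deriv_F: "(F K has_derivative
      (\<lambda>w. integral {-K..0} (\<lambda>t. dir_deriv (flow_deriv t x w) (h 2) (flow t x)))) (at x)" for K x
    unfolding F_def[abs_def] by (rule has_derivative_flow_integral[OF sm])
  have int: "integral {-K..0} (\<lambda>t. dir_deriv (flow_deriv t x (frame i x)) (h 2) (flow t x)) = h i x"
    if "x $ 2 < K - R" "0 \<le> K" for K x i
  proof -
    define c where "c = (if i = 1 then 1 else 0 :: real)"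
    have "dir_deriv (flow_deriv t x (frame i x)) (h 2) (flow t x)
       = X 2 (h i) (flow t x) + c * (t * X 2 (h 3) (flow t x) + h 3 (flow t x))" for t
    proof -
      note lin = linear_frechet_derivative[OF smooth_imp_differentiable[OF sm[of 2]]]
      have "dir_deriv (flow_deriv t x (frame i x)) (h 2) (flow t x)
        = X i (h 2) (flow t x) + c * (t * X 3 (h 2) (flow t x))"
        by (simp add: flow_deriv_frame X_eq_dir_deriv smooth_imp_differentiable sm
            linear_add[OF lin] linear_cmul[OF lin] c_def)
      then show ?thesis
        by (simp add: closed c_def)
    qed
    \<comment> \<open>For \<open>i = 1\<close> the field X_1 + t X_3 applied to \<open>h 2\<close>
      yields X_2 h_1 + h_3 + t X_2 h_3, and the last two terms are the time derivative of t
      h_3.\<close>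
    moreover have "((\<lambda>t. h i (flow t x) + c * (t * h 3 (flow t x))) has_vector_derivative
        X 2 (h i) (flow t x) + c * (t * X 2 (h 3) (flow t x) + h 3 (flow t x))) (at t within S)" for t S
      by (auto intro!: derivative_eq_intros X_2_flow sm)
    \<comment> \<open>At time \<open>-K\<close> the boundary terms vanish by \<open>R2\<close>. At
      time 0 the factor \<open>t\<close> removes the term with \<open>h 3\<close> and leaves
      \<open>h i x\<close>.\<close>
    from fundamental_theorem_of_calculus[OF _ this, of "-K" 0] that
    have "((\<lambda>t. X 2 (h i) (flow t x) + c * (t * X 2 (h 3) (flow t x) + h 3 (flow t x)))
        has_integral h i x) {-K..0}"
      using R2[of "flow (-K) x"] by (simp add: flow_0 flow_nth)
    ultimately show ?thesis
      by (simp add: integral_unique)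
  qed
  have deriv_f: "\<exists>D. (f has_derivative D) (at x) \<and> (\<forall>i. D (frame i x) = h i x)" for x
  proof -
    define K where "K = \<bar>x$2\<bar> + \<bar>R\<bar> + 1"
    have "open {y :: engel. y $ 2 < K - R}"
      by (intro open_Collect_less continuous_intros)
    then have "(f has_derivative
      (\<lambda>w. integral {-K..0} (\<lambda>t. dir_deriv (flow_deriv t x w) (h 2) (flow t x)))) (at x)"
      by (rule has_derivative_transform_within_open[OF deriv_F]) (auto simp: f_eq_F K_def)
    moreover have "x $ 2 < K - R" "0 \<le> K"
      by (auto simp: K_def)
    ultimately show ?thesis
      using int by blast
  qed
  then have diff: "f differentiable (at x)" for x
    by (meson differentiableI)
  have X_f: "X i f = h i" for i
    using deriv_f by (metis X_eq ext)
  have "smooth f"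
    by (rule smooth_if_smooth_X) (simp_all add: diff X_f sm)
  moreover have "f x = 0" if "\<bar>R\<bar> < norm x" for x
  proof -
    \<comment> \<open>A base point outside the ball whose entire backward orbit stays where
      \<open>h 2\<close> vanishes, so \<open>f y = 0\<close>. The absolute value is taken because
      \<open>R\<close> may be negative.\<close>
    define y :: engel where "y = (- \<bar>R\<bar> - 1) *\<^sub>R axis 2 1"
    have "flow t y $ 2 < - R" if "t \<le> 0" for t
      using that by (simp add: flow_nth y_def)
    then have "f y = integral {..0} (\<lambda>t::real. 0)"
      unfolding f_def by (intro integral_cong R2) simp
    moreover have "f x = f y"
    \<comment> \<open>The exterior of a ball is connected in dimension 4, and there all
      \<open>X i f = h i\<close> vanish, so \<open>f\<close> has the same value at \<open>x\<close>
      and \<open>y\<close>.\<close>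
    proof (rule has_derivative_zero_unique_connected[where f = f and s = "- cball 0 \<bar>R\<bar>"])
      show "open (- cball (0::engel) \<bar>R\<bar>)" "connected (- cball (0::engel) \<bar>R\<bar>)"
        by (auto intro!: connected_complement_bounded_convex)
      show "(f has_derivative (\<lambda>x. 0)) (at z)" if "z \<in> - cball 0 \<bar>R\<bar>" for z
        using that by (intro has_derivative_0_if_X_0 diff) (auto simp: X_f R)
      show "x \<in> - cball 0 \<bar>R\<bar>" "y \<in> - cball 0 \<bar>R\<bar>"
        using that by (auto simp: y_def norm_axis_1)
    qed
    ultimately show ?thesis by simp
  qed
  ultimately have "f \<in> C_c_infinity"
    by (auto simp: C_c_infinity_iff)
  with X_f show ?thesis
    using that by blast
qed

section \<open>Forms of degree one and two\<close>

lemma wedge_add_right: "u \<and>\<^sub>e (v + w) = u \<and>\<^sub>e v + u \<and>\<^sub>e w"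
  by (simp add: wedge_def vec_eq_iff ring_distribs sum.distrib)

lemma wedge_scaleR_right: "u \<and>\<^sub>e (c *\<^sub>R v) = c *\<^sub>R (u \<and>\<^sub>e v)"
  by (simp add: wedge_def vec_eq_iff sum_distrib_left mult_ac)

lemma d_inv_add: "d_inv (u + v) = d_inv u + d_inv v"
  by (simp add: d_inv_def scaleR_add_left sum.distrib)

lemma d_inv_scaleR: "d_inv (c *\<^sub>R u) = c *\<^sub>R d_inv u"
  by (simp add: d_inv_def scaleR_sum_right mult.assoc)

lemma one_form_nth: "\<theta> i $ I = (if I = {i} then 1 else 0)"
  by (simp add: one_form_def axis_def)

lemma inversions_singleton: "inversions {i} {j} = (if pos j < pos i then 1 else 0)"
proof -
  have "{(a, b). a \<in> {i} \<and> b \<in> {j} \<and> pos b < pos a} = (if pos j < pos i then {(i, j)} else {})"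
    by auto
  then show ?thesis
    by (simp add: inversions_def)
qed

lemma wedge_one_form:
  "\<theta> i \<and>\<^sub>e \<theta> j = (if i = j then 0 else if pos j < pos i then - axis {i, j} 1 else axis {i, j} 1)"
  by (simp add: one_form_def wedge_axis inversions_singleton insert_commute)

lemma X_scaleR:
  assumes "smooth f"
  shows "X i (\<lambda>x. f x *\<^sub>R c) x = X i f x *\<^sub>R c"
  using X_eq[OF has_derivative_scaleR_left[OF smooth_has_derivative[OF assms]]]
  by (simp add: X_eq_dir_deriv smooth_imp_differentiable assms)

text \<open>Since \<open>d1\<close> and \<open>d2\<close> apply \<open>X i\<close> to the whole
  form, this passes the differentiation to the coefficients.\<close>

lemma X_scaleR_add:
  assumes "smooth f" "smooth g"
  shows "X i (\<lambda>x. f x *\<^sub>R c + g x *\<^sub>R d) x = X i f x *\<^sub>R c + X i g x *\<^sub>R d"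
  using X_eq[OF has_derivative_add[OF assms[THEN smooth_has_derivative, THEN has_derivative_scaleR_left]]]
  by (simp add: X_eq_dir_deriv smooth_imp_differentiable assms)

lemma d0_horizontal: "d0 (\<lambda>x. f x *\<^sub>R \<theta> 1 + g x *\<^sub>R \<theta> 2) = (\<lambda>x. 0)"
  by (simp add: d0_def d_inv_add d_inv_scaleR d_inv_one_form d\<theta>_def)

lemma d0_theta_3: "d0 (\<lambda>x. f x *\<^sub>R \<theta> 3) = (\<lambda>x. - f x *\<^sub>R axis {1, 2} 1)"
  by (simp add: d0_def d_inv_scaleR d_inv_one_form d\<theta>_def wedge_one_form pos_def)

lemma d0_theta_4: "d0 (\<lambda>x. f x *\<^sub>R \<theta> 4) = (\<lambda>x. - f x *\<^sub>R axis {1, 3} 1)"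
  by (simp add: d0_def d_inv_scaleR d_inv_one_form d\<theta>_def wedge_one_form pos_def)

lemma d1_of_fun:
  assumes "smooth f"
  shows "d1 (of_fun f) = (\<lambda>x. X 1 f x *\<^sub>R \<theta> 1 + X 2 f x *\<^sub>R \<theta> 2)"
  by (simp add: d1_def of_fun_def X_scaleR[OF assms] wedge_scaleR_right wedge_one)

lemma d1_horizontal:
  assumes "smooth f" "smooth g"
  shows "d1 (\<lambda>x. f x *\<^sub>R \<theta> 1 + g x *\<^sub>R \<theta> 2) = (\<lambda>x. (X 1 g x - X 2 f x) *\<^sub>R axis {1, 2} 1)"
  by (simp add: d1_def X_scaleR_add assms wedge_add_right wedge_scaleR_right wedge_one_form pos_def
      insert_commute scaleR_diff_left)

lemma d1_theta_3:
  assumes "smooth f"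
  shows "d1 (\<lambda>x. f x *\<^sub>R \<theta> 3) = (\<lambda>x. X 1 f x *\<^sub>R axis {1, 3} 1 + X 2 f x *\<^sub>R axis {2, 3} 1)"
  by (simp add: d1_def X_scaleR assms wedge_scaleR_right wedge_one_form pos_def)

text \<open>The signs arise from moving \<open>\<theta> 3\<close> behind \<open>\<theta> 1\<close>
  and \<open>\<theta> 2\<close>.\<close>

lemma d2_horizontal:
  assumes "smooth f" "smooth g"
  shows "d2 (\<lambda>x. f x *\<^sub>R \<theta> 1 + g x *\<^sub>R \<theta> 2)
    = (\<lambda>x. - X 3 f x *\<^sub>R axis {1, 3} 1 - X 3 g x *\<^sub>R axis {2, 3} 1)"
  by (simp add: d2_def X_scaleR_add assms wedge_add_right wedge_scaleR_right wedge_one_form pos_def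
      insert_commute)

section \<open>One-forms of pure weight and the equations of \<open>Z3_10_c\<close>\<close>

lemma Omega_c_one_form_iff:
  "\<omega> \<in> Omega_c p (1 - p) \<longleftrightarrow> (\<forall>I. (\<lambda>x. \<omega> x $ I) \<in> C_c_infinity) \<and>
     (\<forall>x I. \<omega> x $ I \<noteq> 0 \<longrightarrow> (\<exists>i. I = {i} \<and> int (weight i) = p))"
proof -
  \<comment> \<open>Weight \<open>p\<close> and second degree \<open>1 - p\<close> add up to total
    degree 1, so \<open>I\<close> is a singleton.\<close>
  have "int (\<Sum>i\<in>I. weight i) = p \<and> int (card I) = p + (1 - p) \<longleftrightarrow> (\<exists>i. I = {i} \<and> int (weight i) = p)" for I
    by (auto simp: card_1_singleton_iff)
  then show ?thesis
    by (simp add: Omega_c_def)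
qed

lemma Omega_c_horizontal_iff:
  "\<omega> \<in> Omega_c 1 0 \<longleftrightarrow> (\<exists>f \<in> C_c_infinity. \<exists>g \<in> C_c_infinity. \<omega> = (\<lambda>x. f x *\<^sub>R \<theta> 1 + g x *\<^sub>R \<theta> 2))"
proof
  assume "\<omega> \<in> Omega_c 1 0"
  then have C: "(\<lambda>x. \<omega> x $ I) \<in> C_c_infinity" and w: "\<omega> x $ I \<noteq> 0 \<Longrightarrow> I = {1} \<or> I = {2}" for x I
    using Omega_c_one_form_iff[of \<omega> 1] by (auto simp: weight_def split: if_splits)
  have "\<omega> = (\<lambda>x. \<omega> x $ {1} *\<^sub>R \<theta> 1 + \<omega> x $ {2} *\<^sub>R \<theta> 2)"
    using w by (fastforce simp: fun_eq_iff vec_eq_iff one_form_nth)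
  then show "\<exists>f \<in> C_c_infinity. \<exists>g \<in> C_c_infinity. \<omega> = (\<lambda>x. f x *\<^sub>R \<theta> 1 + g x *\<^sub>R \<theta> 2)"
    by (rule bexI[OF bexI[OF _ C] C])
next
  assume "\<exists>f \<in> C_c_infinity. \<exists>g \<in> C_c_infinity. \<omega> = (\<lambda>x. f x *\<^sub>R \<theta> 1 + g x *\<^sub>R \<theta> 2)"
  then obtain f g where "f \<in> C_c_infinity" "g \<in> C_c_infinity"
    and "\<omega> x $ I = (if I = {1} then f x else if I = {2} then g x else 0)" for x I
    by (auto simp: one_form_nth)
  moreover from this have "(\<lambda>x. \<omega> x $ I) \<in> C_c_infinity" for I
    by (cases "I = {1}"; cases "I = {2}") (simp_all add: C_c_infinity_0)
  ultimately show "\<omega> \<in> Omega_c 1 0"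
    using Omega_c_one_form_iff[of \<omega> 1] by (simp add: weight_def split: if_splits)
qed

text \<open>Intended for the weights 2 and 3, each of which belongs to a single element of the
  coframe.\<close>

lemma Omega_c_theta_iff:
  assumes "\<And>j. int (weight j) = p \<longleftrightarrow> j = i"
  shows "\<omega> \<in> Omega_c p (1 - p) \<longleftrightarrow> (\<exists>f \<in> C_c_infinity. \<omega> = (\<lambda>x. f x *\<^sub>R \<theta> i))"
proof
  assume "\<omega> \<in> Omega_c p (1 - p)"
  then have C: "(\<lambda>x. \<omega> x $ I) \<in> C_c_infinity" and w: "\<omega> x $ I \<noteq> 0 \<Longrightarrow> I = {i}" for x I
    using Omega_c_one_form_iff[of \<omega> p] by (auto simp: assms)
  have "\<omega> = (\<lambda>x. \<omega> x $ {i} *\<^sub>R \<theta> i)"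
    using w by (fastforce simp: fun_eq_iff vec_eq_iff one_form_nth)
  then show "\<exists>f \<in> C_c_infinity. \<omega> = (\<lambda>x. f x *\<^sub>R \<theta> i)"
    by (rule bexI[OF _ C])
next
  assume "\<exists>f \<in> C_c_infinity. \<omega> = (\<lambda>x. f x *\<^sub>R \<theta> i)"
  then show "\<omega> \<in> Omega_c p (1 - p)"
    by (auto simp: Omega_c_one_form_iff assms one_form_nth C_c_infinity_0 split: if_splits)
qed

lemma Omega_c_theta_3_iff: "\<omega> \<in> Omega_c 2 (- 1) \<longleftrightarrow> (\<exists>f \<in> C_c_infinity. \<omega> = (\<lambda>x. f x *\<^sub>R \<theta> 3))"
  using Omega_c_theta_iff[of 2 3 \<omega>] by (simp add: weight_def)

lemma Omega_c_theta_4_iff: "\<omega> \<in> Omega_c 3 (- 2) \<longleftrightarrow> (\<exists>f \<in> C_c_infinity. \<omega> = (\<lambda>x. f x *\<^sub>R \<theta> 4))"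
proof -
  have "int (weight j) = 3 \<longleftrightarrow> j = 4" for j
    using exhaust_4[of j] by (auto simp: weight_def)
  from Omega_c_theta_iff[OF this] show ?thesis
    by simp
qed

text \<open>Put \<open>z2\<close> as g3 \<theta>_3 and \<open>z3\<close> as g4 \<theta>_4. The three
  equations compare the coefficients of \<theta>_1 \<and> \<theta>_2 in the first condition and of
  \<theta>_1 \<and> \<theta>_3 and \<theta>_2 \<and> \<theta>_3 in the second; \<open>d0 z3\<close>
  contributes to \<theta>_1 \<and> \<theta>_3.\<close>

lemma Z3_10_c_iff:
  "\<alpha> \<in> Z3_10_c \<longleftrightarrow> (\<exists>f1 \<in> C_c_infinity. \<exists>f2 \<in> C_c_infinity. \<alpha> = (\<lambda>x. f1 x *\<^sub>R \<theta> 1 + f2 x *\<^sub>R \<theta> 2) \<and>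
     (\<exists>g3 \<in> C_c_infinity. \<exists>g4 \<in> C_c_infinity. \<forall>x. X 1 f2 x - X 2 f1 x = - g3 x \<and>
        - X 3 f1 x = - g4 x + X 1 g3 x \<and> - X 3 f2 x = X 2 g3 x))"
proof -
  have eq12: "(\<lambda>x. a x *\<^sub>R axis {1, 2} 1) = (\<lambda>x. b x *\<^sub>R axis {1, 2} 1 :: covector) \<longleftrightarrow> (\<forall>x. a x = b x)"
    for a b :: "engel \<Rightarrow> real"
    by (auto simp: fun_eq_iff)
  have eq13: "(\<lambda>x. a x *\<^sub>R axis {1, 3} 1 - b x *\<^sub>R axis {2, 3} 1) =
      (\<lambda>x. c x *\<^sub>R axis {1, 3} 1 + (d x *\<^sub>R axis {1, 3} 1 + e x *\<^sub>R axis {2, 3} 1) :: covector)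
      \<longleftrightarrow> (\<forall>x. a x = c x + d x \<and> - b x = e x)"
    for a b c d e :: "engel \<Rightarrow> real"
  proof -
    have "a x *\<^sub>R axis {1, 3} 1 - b x *\<^sub>R axis {2, 3} 1 =
      (c x *\<^sub>R axis {1, 3} 1 + (d x *\<^sub>R axis {1, 3} 1 + e x *\<^sub>R axis {2, 3} 1) :: covector)
      \<longleftrightarrow> a x = c x + d x \<and> - b x = e x" (is "?l = ?r \<longleftrightarrow> _") for x
    proof
      assume "?l = ?r"
      from arg_cong[OF this, of "\<lambda>v. v $ {1, 3}"] arg_cong[OF this, of "\<lambda>v. v $ {2, 3}"]
      show "a x = c x + d x \<and> - b x = e x"
        by (simp add: axis_def doubleton_eq_iff)
    next
      assume "a x = c x + d x \<and> - b x = e x"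
      then have "a x = c x + d x" "e x = - b x"
        by auto
      then show "?l = ?r"
        by (simp add: scaleR_add_left)
    qed
    then show ?thesis
      by (simp add: fun_eq_iff)
  qed
  have "(\<exists>z2 \<in> Omega_c 2 (-1). \<exists>z3 \<in> Omega_c 3 (-2). d1 \<alpha> = d0 z2 \<and> d2 \<alpha> = (\<lambda>x. d0 z3 x + d1 z2 x))
    \<longleftrightarrow> (\<exists>g3 \<in> C_c_infinity. \<exists>g4 \<in> C_c_infinity. \<forall>x. X 1 f2 x - X 2 f1 x = - g3 x \<and>
        - X 3 f1 x = - g4 x + X 1 g3 x \<and> - X 3 f2 x = X 2 g3 x)"
    if "\<alpha> = (\<lambda>x. f1 x *\<^sub>R \<theta> 1 + f2 x *\<^sub>R \<theta> 2)" "f1 \<in> C_c_infinity" "f2 \<in> C_c_infinity" for f1 f2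
  proof -
    have "d1 \<alpha> = d0 (\<lambda>x. g3 x *\<^sub>R \<theta> 3) \<and> d2 \<alpha> = (\<lambda>x. d0 (\<lambda>x. g4 x *\<^sub>R \<theta> 4) x + d1 (\<lambda>x. g3 x *\<^sub>R \<theta> 3) x)
      \<longleftrightarrow> (\<forall>x. X 1 f2 x - X 2 f1 x = - g3 x \<and>
        - X 3 f1 x = - g4 x + X 1 g3 x \<and> - X 3 f2 x = X 2 g3 x)" if "g3 \<in> C_c_infinity" for g3 g4
      using that \<open>f1 \<in> _\<close> \<open>f2 \<in> _\<close> unfolding \<open>\<alpha> = _\<close> C_c_infinity_iff
      by (simp only: d1_horizontal d2_horizontal d1_theta_3 d0_theta_3 d0_theta_4 eq12 eq13) blast
    then show ?thesis
      unfolding Bex_def Omega_c_theta_3_iff Omega_c_theta_4_iff by blast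
  qed
  then show ?thesis
    unfolding Z3_10_c_def Omega_c_horizontal_iff mem_Collect_eq using d0_horizontal by blast
qed

theorem lemma2p28:
  shows "Z3_10_c = {(\<lambda>x. X 1 f x *\<^sub>R \<theta> 1 + X 2 f x *\<^sub>R \<theta> 2) | f. f \<in> C_c_infinity} \<and>
    {(\<lambda>x. X 1 f x *\<^sub>R \<theta> 1 + X 2 f x *\<^sub>R \<theta> 2) | f. f \<in> C_c_infinity}
      = (\<lambda>f. d1 (of_fun f)) ` C_c_infinity"
proof (rule conjI[rotated], goal_cases)
  case 1
  have "(\<lambda>f. d1 (of_fun f)) ` C_c_infinity =
      (\<lambda>f x. X 1 f x *\<^sub>R \<theta> 1 + X 2 f x *\<^sub>R \<theta> 2) ` C_c_infinity"
    by (intro image_cong refl d1_of_fun) (simp add: C_c_infinity_iff)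
  then show ?case
    by (simp add: Setcompr_eq_image)
next
  case 2
  show ?case
  proof (intro set_eqI iffI)
    fix \<alpha>
    assume "\<alpha> \<in> Z3_10_c"
    then obtain f1 f2 g3 g4 where f: "f1 \<in> C_c_infinity" "f2 \<in> C_c_infinity"
      and \<alpha>: "\<alpha> = (\<lambda>x. f1 x *\<^sub>R \<theta> 1 + f2 x *\<^sub>R \<theta> 2)"
      and g: "g3 \<in> C_c_infinity" "g4 \<in> C_c_infinity"
      and eq: "\<And>x. X 1 f2 x - X 2 f1 x = - g3 x" "\<And>x. - X 3 f1 x = - g4 x + X 1 g3 x"
        "\<And>x. - X 3 f2 x = X 2 g3 x"
      unfolding Z3_10_c_iff by blast
    have sm: "smooth f1" "smooth f2" "smooth g3" "smooth g4"
      using f g by (auto simp: C_c_infinity_iff)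
    \<comment> \<open>The prospective derivatives of the potential: if \<open>f1\<close> and
      \<open>f2\<close> are X_1 f and X_2 f, the equations force g3 = - X_3 f and g4 = - X_4
      f.\<close>
    define h where "h i = (if i = 1 then f1 else if i = 2 then f2
        else if i = 3 then (\<lambda>x. - g3 x) else (\<lambda>x. - g4 x))"
      for i :: 4
    have X1f2: "X 1 f2 = (\<lambda>x. X 2 f1 x - g3 x)" and X3f2: "X 3 f2 = (\<lambda>x. - X 2 g3 x)"
      and X3f1: "g4 = (\<lambda>x. X 3 f1 x + X 1 g3 x)"
      using eq by (auto simp: fun_eq_iff algebra_simps) (metis add.inverse_inverse)
    have "X 4 f2 x = - X 2 g4 x" for x
    proof -
      \<comment> \<open>X_4 is the commutator of X_1 and X_3, and both derivatives of
        \<open>f2\<close> are known from the equations. The terms in \<open>g3\<close> then combine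
        by [X_1, X_2] = X_3, and X_2 commutes with X_3 on \<open>f1\<close>.\<close>
      have "X 4 f2 x = X 1 (\<lambda>x. - X 2 g3 x) x - X 3 (\<lambda>x. X 2 f1 x - g3 x) x"
        using X_commute(2)[OF sm(2), of x] by (simp add: X1f2 X3f2)
      also have "\<dots> = - X 1 (X 2 g3) x + X 3 g3 x - X 3 (X 2 f1) x"
        by (simp add: X_minus X_diff sm smooth_X)
      also have "\<dots> = - X 2 g4 x"
        using X_commute(1)[OF sm(3), of x] X_commute(3)[OF sm(1), of x]
        by (simp add: X3f1 X_add sm smooth_X)
      finally show ?thesis .
    qed
    then have "X i (h 2) x = X 2 (h i) x + (if i = 1 then h 3 x else 0)" for i x
      using exhaust_4[of i] by (auto simp: h_def X1f2 X3f2 X_minus sm)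
    moreover have "h i \<in> C_c_infinity" for i
      using f g by (simp add: h_def C_c_infinity_minus)
    ultimately obtain f where "f \<in> C_c_infinity" and X_f: "\<And>i. X i f = h i"
      using compactly_supported_potential by blast
    moreover have "\<alpha> = (\<lambda>x. X 1 f x *\<^sub>R \<theta> 1 + X 2 f x *\<^sub>R \<theta> 2)"
      by (simp add: X_f \<alpha> h_def)
    ultimately show "\<alpha> \<in> {(\<lambda>x. X 1 f x *\<^sub>R \<theta> 1 + X 2 f x *\<^sub>R \<theta> 2) | f. f \<in> C_c_infinity}"
      by blast
  next
    fix \<alpha>
    assume "\<alpha> \<in> {(\<lambda>x. X 1 f x *\<^sub>R \<theta> 1 + X 2 f x *\<^sub>R \<theta> 2) | f. f \<in> C_c_infinity}"
    then obtain f where f: "f \<in> C_c_infinity" and \<alpha>: "\<alpha> = (\<lambda>x. X 1 f x *\<^sub>R \<theta> 1 + X 2 f x *\<^sub>R \<theta> 2)"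
      by blast
    have sm: "smooth f"
      using f by (simp add: C_c_infinity_iff)
    \<comment> \<open>With g3 = - X_3 f and g4 = - X_4 f the defining equations become the three
      commutator relations applied to \<open>f\<close>.\<close>
    have "X 1 (X 2 f) x - X 2 (X 1 f) x = - (- X 3 f x)"
      "- X 3 (X 1 f) x = - (- X 4 f x) + X 1 (\<lambda>x. - X 3 f x) x"
      "- X 3 (X 2 f) x = X 2 (\<lambda>x. - X 3 f x) x" for x
      using X_commute[OF sm, of x] by (simp_all add: X_minus sm smooth_X)
    then have "\<exists>g3 \<in> C_c_infinity. \<exists>g4 \<in> C_c_infinity. \<forall>x. X 1 (X 2 f) x - X 2 (X 1 f) x = - g3 x \<and>
        - X 3 (X 1 f) x = - g4 x + X 1 g3 x \<and> - X 3 (X 2 f) x = X 2 g3 x"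
      using f by (intro bexI[of _ "\<lambda>x. - X 3 f x"] bexI[of _ "\<lambda>x. - X 4 f x"])
        (auto intro: C_c_infinity_X C_c_infinity_minus)
    then show "\<alpha> \<in> Z3_10_c"
      unfolding Z3_10_c_iff \<alpha> using C_c_infinity_X[OF f] by blast
  qed
qed

end
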